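(* Let $q$ be real and generic, let $a,b$ be nonzero real parameters, let $\alpha_1=a^{-2}bq^{-1}(q-1)^2(q+1)$ and $\alpha_2=a^{-2}q^{-1}(q-1)(ab+aq+bq)$, and let the Pastro algebra be the algebra with generators $X,Y,Z$ defined by the relations $$qXY-YX=1,\qquad qYZ-ZY=\alpha_1X+\alpha_2,\qquad qZX-XZ=1.$$ Then the element $$Q=(q^{-2}-1)XYZ+q^{-1}\alpha_1X^2+q^{-1}(q^{-1}+1)\left(\alpha_2X+q^{-1}Y+Z\right)$$ is central in the Pastro algebra. Furthermore, let $\mu$ be an arbitrary real parameter and set $$L=X+\mu Y,\qquad M=qLZ-ZL-\mu\alpha_2-1.$$ Then the elements $L,M,Z$ together with the central element $Q$ generate an algebra with the relations $$qLZ-ZL=M+\mu\alpha_2+1,$$ $$qZM-MZ=\mu\alpha_1,$$ $$qML-LM=\mu q^{-1}(q+1)^2(q-1)Z-\mu q^2(q-1)Q+\mu^2\alpha_1.$$ Consequently, the $q$-Hahn algebra, with generators $A,B,C$ and relations $$qAB-BA=C+\gamma_1,\qquad qBC-CB=\gamma_2,\qquad qCA-AC=\gamma_3B+\gamma_4,$$ is embedded in the Pastro algebra under the mappings $$A\mapsto L,\qquad B\mapsto Z,\qquad C\mapsto M,$$ $$\gamma_1\mapsto\mu\alpha_2+1,\qquad \gamma_2\mapsto\mu\alpha_1,\qquad \gamma_3\mapsto\mu q^{-1}(q+1)^2(q-1),\qquad \gamma_4\mapsto-\mu q^2(q-1)Q+\mu^2\alpha_1.$$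
   Context: In the $q$-Hahn algebra the coefficients $\gamma_1,\gamma_2,\gamma_3,\gamma_4$ are usually arbitrary real constants; here they are viewed instead as central elements. Real scalars are identified with multiples of the unit. Up to affine transformations of the generators, the relations of the Pastro algebra are those satisfied by the three $q$-difference operators $(x-q)T^-+(q-bx)\mathcal{I}$, $(x-a^{-1}q)T^++(a^{-1}q-b^{-1}x)\mathcal{I}$ and $(1-qx^{-1})T^-+(qx^{-1}-b)\mathcal{I}$ (corresponding to $X,Y,Z$ respectively), where $T^{\pm}f(x)=f(q^{\pm1}x)$ and $\mathcal{I}$ is the identity operator.
   Formalization: "Embedded" is stated as a real-algebra homomorphism with the given values, not an injective one (γ1−(μα2+1) is nonzero but maps to 0); "generate an algebra with the relations" says only that the relations hold, not that they are a complete presentation. *)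

theory Defs
  imports "HOL-Algebra.QuotRing" "HOL-Algebra.Generated_Rings" "HOL-Library.Poly_Mapping"
begin

section \<open>Free associative unital real algebras\<close>

datatype 'g word = Word (letters: "'g list")

instantiation word :: (type) monoid_add
begin

definition zero_word :: "'a word" where
  "0 = Word []"

definition plus_word :: "'a word \<Rightarrow> 'a word \<Rightarrow> 'a word" where
  "u + v = Word (letters u @ letters v)"

instance
  by standard (simp_all add: zero_word_def plus_word_def)

end

instantiation poly_mapping :: (monoid_add, real_algebra_1) real_algebra_1
begin

definition scaleR_poly_mapping :: "real \<Rightarrow> ('a \<Rightarrow>\<^sub>0 'b) \<Rightarrow> ('a \<Rightarrow>\<^sub>0 'b)" where
  "c *\<^sub>R p = Poly_Mapping.single 0 (of_real c) * p"

lemma single_of_real_commute: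
  "p * Poly_Mapping.single 0 (of_real c) = Poly_Mapping.single 0 (of_real c) * (p :: 'a \<Rightarrow>\<^sub>0 'b)"
proof (induction p rule: update_induct)
  case (update f k v)
  have "Poly_Mapping.update k v f = f + Poly_Mapping.single k v"
    using update.hyps(1)
    by (intro poly_mapping_eqI) (auto simp: lookup_update lookup_add lookup_single in_keys_iff when_def)
  with update.IH show ?case
    by (simp add: distrib_left distrib_right Poly_Mapping.mult_single of_real_def)
qed simp

instance
proof
  fix c d :: real and p r :: "'a \<Rightarrow>\<^sub>0 'b"
  show "c *\<^sub>R (p + r) = c *\<^sub>R p + c *\<^sub>R r"
    by (simp add: scaleR_poly_mapping_def distrib_left)
  show "(c + d) *\<^sub>R p = c *\<^sub>R p + d *\<^sub>R p"
    by (simp add: scaleR_poly_mapping_def Poly_Mapping.single_add distrib_right)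
  show "c *\<^sub>R d *\<^sub>R p = (c * d) *\<^sub>R p"
    by (simp add: scaleR_poly_mapping_def Poly_Mapping.mult_single flip: mult.assoc)
  show "1 *\<^sub>R p = p"
    by (simp add: scaleR_poly_mapping_def)
  show "c *\<^sub>R p * r = c *\<^sub>R (p * r)"
    by (simp add: scaleR_poly_mapping_def mult.assoc)
  show "p * c *\<^sub>R r = c *\<^sub>R (p * r)"
    unfolding scaleR_poly_mapping_def
    by (metis mult.assoc single_of_real_commute)
qed

end

type_synonym 'g free_algebra = "'g word \<Rightarrow>\<^sub>0 real"

definition gen :: "'g \<Rightarrow> 'g free_algebra" where
  "gen g = Poly_Mapping.single (Word [g]) 1"

definition free_algebra_ring :: "'g free_algebra ring" where
  "free_algebra_ring =
     \<lparr>carrier = UNIV, monoid.mult = (*), one = 1, zero = 0, add = (+)\<rparr>"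


section \<open>Algebras given by generators and relations\<close>

text \<open>An element \<open>r\<close> of \<open>R\<close> encodes the relation \<open>r = 0\<close>; \<open>Idl\<close> is the generated
  two-sided ideal. The elements of a presented algebra are cosets.\<close>

definition presented_algebra :: "'g free_algebra set \<Rightarrow> 'g free_algebra set ring" where
  "presented_algebra R = free_algebra_ring Quot (Idl\<^bsub>free_algebra_ring\<^esub> R)"

definition rel_class :: "'g free_algebra set \<Rightarrow> 'g free_algebra \<Rightarrow> 'g free_algebra set" where
  "rel_class R x = (Idl\<^bsub>free_algebra_ring\<^esub> R) +>\<^bsub>free_algebra_ring\<^esub> x"

text \<open>Real scalars are the classes of \<open>of_real c\<close>, so \<open>\<real>\<close>-linear ring homomorphisms are those
  that fix the scalars.\<close>

definition real_algebra_hom ::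
    "'g free_algebra set \<Rightarrow> 'h free_algebra set \<Rightarrow> ('g free_algebra set \<Rightarrow> 'h free_algebra set) set"
  where "real_algebra_hom R S =
    {\<phi> \<in> ring_hom (presented_algebra R) (presented_algebra S).
       \<forall>c. \<phi> (rel_class R (of_real c)) = rel_class S (of_real c)}"

definition generated_subalgebra ::
    "'g free_algebra set \<Rightarrow> 'g free_algebra set set \<Rightarrow> 'g free_algebra set set" where
  "generated_subalgebra R G =
     generate_ring (presented_algebra R) (G \<union> range (\<lambda>c. rel_class R (of_real c)))"


section \<open>The Pastro algebra\<close>

definition alpha1 :: "real \<Rightarrow> real \<Rightarrow> real \<Rightarrow> real" where
  "alpha1 q a b = a powi (-2) * b * q powi (-1) * (q - 1)^2 * (q + 1)"

definition alpha2 :: "real \<Rightarrow> real \<Rightarrow> real \<Rightarrow> real" where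
  "alpha2 q a b = a powi (-2) * q powi (-1) * (q - 1) * (a * b + a * q + b * q)"

datatype pastro_gen = PX | PY | PZ

abbreviation X :: "pastro_gen free_algebra" where "X \<equiv> gen PX"
abbreviation Y :: "pastro_gen free_algebra" where "Y \<equiv> gen PY"
abbreviation Z :: "pastro_gen free_algebra" where "Z \<equiv> gen PZ"

definition pastro_rels :: "real \<Rightarrow> real \<Rightarrow> real \<Rightarrow> pastro_gen free_algebra set" where
  "pastro_rels q a b =
     {(q *\<^sub>R (X * Y) - Y * X) - 1,
      (q *\<^sub>R (Y * Z) - Z * Y) - (alpha1 q a b *\<^sub>R X + of_real (alpha2 q a b)),
      (q *\<^sub>R (Z * X) - X * Z) - 1}"

abbreviation pastro_algebra :: "real \<Rightarrow> real \<Rightarrow> real \<Rightarrow> pastro_gen free_algebra set ring" where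
  "pastro_algebra q a b \<equiv> presented_algebra (pastro_rels q a b)"

abbreviation pastro_class ::
    "real \<Rightarrow> real \<Rightarrow> real \<Rightarrow> pastro_gen free_algebra \<Rightarrow> pastro_gen free_algebra set" where
  "pastro_class q a b \<equiv> rel_class (pastro_rels q a b)"

text \<open>Representatives, in the free algebra on \<open>X, Y, Z\<close>, of the elements \<open>Q\<close>, \<open>L\<close>, \<open>M\<close> of the
  Pastro algebra.\<close>

definition pastro_Q :: "real \<Rightarrow> real \<Rightarrow> real \<Rightarrow> pastro_gen free_algebra" where
  "pastro_Q q a b =
     (q powi (-2) - 1) *\<^sub>R (X * Y * Z)
     + (q powi (-1) * alpha1 q a b) *\<^sub>R X^2
     + (q powi (-1) * (q powi (-1) + 1)) *\<^sub>R (alpha2 q a b *\<^sub>R X + q powi (-1) *\<^sub>R Y + Z)"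

definition pastro_L :: "real \<Rightarrow> pastro_gen free_algebra" where
  "pastro_L \<mu> = X + \<mu> *\<^sub>R Y"

definition pastro_M :: "real \<Rightarrow> real \<Rightarrow> real \<Rightarrow> real \<Rightarrow> pastro_gen free_algebra" where
  "pastro_M q a b \<mu> =
     q *\<^sub>R (pastro_L \<mu> * Z) - Z * pastro_L \<mu> - of_real (\<mu> * alpha2 q a b) - 1"


section \<open>The $q$-Hahn algebra with central structure elements\<close>

text \<open>The structure elements \<open>\<gamma>\<^sub>1, \<dots>, \<gamma>\<^sub>4\<close> are further generators, required to be central.
  A realisation of the \<open>q\<close>-Hahn algebra in the Pastro algebra is a real-linear homomorphism out of
  this algebra. It cannot be injective, since \<open>\<gamma>\<^sub>1, \<gamma>\<^sub>2, \<gamma>\<^sub>3\<close> are sent to scalars.\<close>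

datatype hahn_gen = HA | HB | HC | H\<gamma>1 | H\<gamma>2 | H\<gamma>3 | H\<gamma>4

abbreviation A :: "hahn_gen free_algebra" where "A \<equiv> gen HA"
abbreviation B :: "hahn_gen free_algebra" where "B \<equiv> gen HB"
abbreviation C :: "hahn_gen free_algebra" where "C \<equiv> gen HC"
abbreviation \<gamma>1 :: "hahn_gen free_algebra" where "\<gamma>1 \<equiv> gen H\<gamma>1"
abbreviation \<gamma>2 :: "hahn_gen free_algebra" where "\<gamma>2 \<equiv> gen H\<gamma>2"
abbreviation \<gamma>3 :: "hahn_gen free_algebra" where "\<gamma>3 \<equiv> gen H\<gamma>3"
abbreviation \<gamma>4 :: "hahn_gen free_algebra" where "\<gamma>4 \<equiv> gen H\<gamma>4"

definition hahn_rels :: "real \<Rightarrow> hahn_gen free_algebra set" where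
  "hahn_rels q =
     {(q *\<^sub>R (A * B) - B * A) - (C + \<gamma>1),
      (q *\<^sub>R (B * C) - C * B) - \<gamma>2,
      (q *\<^sub>R (C * A) - A * C) - (\<gamma>3 * B + \<gamma>4)}
     \<union> {g * x - x * g | g x. g \<in> {\<gamma>1, \<gamma>2, \<gamma>3, \<gamma>4}}"

abbreviation hahn_algebra :: "real \<Rightarrow> hahn_gen free_algebra set ring" where
  "hahn_algebra q \<equiv> presented_algebra (hahn_rels q)"

abbreviation hahn_class :: "real \<Rightarrow> hahn_gen free_algebra \<Rightarrow> hahn_gen free_algebra set" where
  "hahn_class q \<equiv> rel_class (hahn_rels q)"

end

theory Submission
  imports Defs
begin

text \<open>The commutators of \<open>Q\<close> with the generators, and the two nontrivial relations between
  \<open>L, M, Z\<close>, are written as explicit two-sided combinations of the defining relators of the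
  Pastro algebra, hence vanish modulo its ideal of relations. The $q$-Hahn algebra is realised by the
  homomorphism induced on the quotient by the universal property of the free algebra; its image
  is the subalgebra generated by the images of the generators, and for \<open>\<mu> \<noteq> 0\<close> the image of \<open>\<gamma>\<^sub>4\<close>
  yields \<open>Q\<close>, because \<open>\<mu> q\<^sup>2 (q - 1)\<close> is then nonzero.\<close>

section \<open>Identities with explicit cofactors\<close>

text \<open>Here \<open>p, \<alpha>, \<beta>\<close> stand for \<open>q\<close> inverse, \<open>\<alpha>\<^sub>1\<close> and \<open>\<alpha>\<^sub>2\<close>; the identities hold in any
  algebra, without imposing the relations \<open>r\<^sub>1 = r\<^sub>2 = r\<^sub>3 = 0\<close>.\<close>

locale pastro_cofactors =
  fixes q p \<alpha> \<beta> :: real and x y z r\<^sub>1 r\<^sub>2 r\<^sub>3 Q :: "'a::real_algebra_1"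
  assumes qp: "q * p = 1"
    and r1: "r\<^sub>1 = (q *\<^sub>R (x * y) - y * x) - 1"
    and r2: "r\<^sub>2 = (q *\<^sub>R (y * z) - z * y) - (\<alpha> *\<^sub>R x + of_real \<beta>)"
    and r3: "r\<^sub>3 = (q *\<^sub>R (z * x) - x * z) - 1"
    and Q: "Q = (p^2 - 1) *\<^sub>R (x * y * z) + (p * \<alpha>) *\<^sub>R x^2
                + (p * (p + 1)) *\<^sub>R (\<beta> *\<^sub>R x + p *\<^sub>R y + z)"
begin

text \<open>The forms with a further factor \<open>c\<close> let \<open>q\<close> and
  \<open>p\<close> cancel inside the longer products that \<open>algebra_simps\<close>
  reorders.\<close>

lemma qp_simps: "q * p = 1" "q * (p * c) = c" "p * q = 1" "p * (q * c) = c"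
  using qp by (auto simp: mult.commute mult.left_commute)

lemmas expand = qp_simps r1 r2 r3 Q algebra_simps power2_eq_square of_real_def

text \<open>Carrying the last letter of \<open>x*y*z*x\<close> to the front uses
  \<open>r\<^sub>3\<close>, then \<open>r\<^sub>1\<close>, with scalar factors \<open>p\<close> and
  \<open>q\<close> that cancel. The leftover multiple of \<open>x*y - x*z\<close> is removed by the
  part \<open>p *\<^sub>R y + z\<close> of \<open>Q\<close>.\<close>

lemma Q_comm_x:
  "Q * x - x * Q = (p * (p^2 - 1)) *\<^sub>R (x * y * r\<^sub>3 - x * r\<^sub>1 * z) + (p^2 * (p + 1)) *\<^sub>R (r\<^sub>3 - r\<^sub>1)"
  by (simp add: expand)

text \<open>The right-hand side of the second relation leaves multiples of \<open>x*y*x\<close> and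
  \<open>x*y\<close>; the commutators of \<open>x^2\<close> and \<open>x\<close> with
  \<open>y\<close> absorb them, and the summand \<open>z\<close> of \<open>Q\<close> absorbs
  \<open>y*z\<close>. The commutator with \<open>z\<close> works by the same mechanism.\<close>

lemma Q_comm_y:
  "Q * y - y * Q = (p^2 - 1) *\<^sub>R (r\<^sub>1 * y * z - x * y * r\<^sub>2)
     + (p * \<alpha>) *\<^sub>R (p *\<^sub>R (x * r\<^sub>1) + r\<^sub>1 * x) + (p * (p + 1)) *\<^sub>R (\<beta> *\<^sub>R r\<^sub>1 - r\<^sub>2)"
  by (simp add: expand)

lemma Q_comm_z:
  "Q * z - z * Q = (p * (p^2 - 1)) *\<^sub>R (x * r\<^sub>2 * z - r\<^sub>3 * y * z)
     - (p * \<alpha>) *\<^sub>R (p^2 *\<^sub>R (x * r\<^sub>3) + p *\<^sub>R (r\<^sub>3 * x)) + (p * (p + 1)) *\<^sub>R (p *\<^sub>R r\<^sub>2 - (p * \<beta>) *\<^sub>R r\<^sub>3)"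
  by (simp add: expand)

context
  fixes \<mu> :: real and l m :: 'a
  assumes l: "l = x + \<mu> *\<^sub>R y"
    and m: "m = q *\<^sub>R (l * z) - z * l - of_real (\<mu> * \<beta>) - 1"
begin

text \<open>Put S(u) = q u z - z u and T(u) = q z u - u z. These operators commute and agree at 1,
  so T(S(x) - 1) = S(T(x) - 1) = S(\<open>r\<^sub>3\<close>). For the \<open>y\<close> part, S(y) is
  replaced by the second relation before T is applied.\<close>

lemma zm_relation:
  "q *\<^sub>R (z * m) - m * z - of_real (\<mu> * \<alpha>)
   = q *\<^sub>R (r\<^sub>3 * z) - z * r\<^sub>3 + (\<mu> * \<alpha>) *\<^sub>R r\<^sub>3 + \<mu> *\<^sub>R (q *\<^sub>R (z * r\<^sub>2) - r\<^sub>2 * z)"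
  by (simp add: l m expand)

text \<open>Removes \<open>z*x\<close> and all occurrences of \<open>y\<close> from
  \<open>m\<close>, up to relators, so that products with \<open>l\<close> stay short.\<close>

lemma m_normal_form:
  "m = (q - p) *\<^sub>R (x * z) - (p + 1) *\<^sub>R 1 + (\<mu> * \<alpha>) *\<^sub>R x + (\<mu> *\<^sub>R r\<^sub>2 - p *\<^sub>R r\<^sub>3)"
  by (simp add: l m expand)

lemma ml_relation:
  defines "n \<equiv> \<mu> *\<^sub>R r\<^sub>2 - p *\<^sub>R r\<^sub>3"
  shows "q *\<^sub>R (m * l) - l * m
     - ((\<mu> * p * (q + 1)^2 * (q - 1)) *\<^sub>R z - (\<mu> * q^2 * (q - 1)) *\<^sub>R Q + of_real (\<mu>^2 * \<alpha>))
   = (q - p) *\<^sub>R (x * r\<^sub>3) + (\<mu> * (q - p)) *\<^sub>R (r\<^sub>1 * z - q *\<^sub>R (x * r\<^sub>2)) + (\<mu>^2 * \<alpha>) *\<^sub>R r\<^sub>1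
     + (q *\<^sub>R (n * l) - l * n)"
  \<comment> \<open>Keeping \<open>n\<close> atomic makes the last bracket cancel without expansion.
    \<open>Q\<close> enters because \<open>q *\<^sub>R (x*z*y) - y*x*z\<close> reduces to a multiple
    of \<open>x*y*z\<close> plus terms of lower degree.\<close>
  unfolding m_normal_form[folded n_def] l Q
  by (simp add: qp_simps r1 r2 r3 algebra_simps power2_eq_square of_real_def)

end

end

section \<open>Free algebras\<close>

text \<open>Turns \<open>update_induct\<close> into induction on adding one new monomial at a
  time.\<close>

lemma update_eq_add_single:
  assumes "k \<notin> Poly_Mapping.keys f"
  shows "Poly_Mapping.update k v f = f + Poly_Mapping.single k v"
  using assms
  by (intro poly_mapping_eqI) (auto simp: lookup_update lookup_add lookup_single in_keys_iff when_def)

lemma lookup_scaleR_free_algebra: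
  "Poly_Mapping.lookup (c *\<^sub>R p) w = c * Poly_Mapping.lookup (p :: 'g free_algebra) w"
proof (induction p rule: update_induct)
  case (update f k v)
  then show ?case
    by (simp add: update_eq_add_single scaleR_poly_mapping_def distrib_left lookup_add
        Poly_Mapping.mult_single lookup_single when_def)
qed (simp add: scaleR_poly_mapping_def)

lemma single_word_eq:
  "Poly_Mapping.single w c = c *\<^sub>R prod_list (map gen (letters w))"
proof -
  have *: "Poly_Mapping.single (Word gs) (1::real) = prod_list (map gen gs)" for gs :: "'a list"
  proof (induction gs)
    case Nil
    then show ?case by (simp flip: zero_word_def)
  next
    case (Cons g gs)
    have "Word (g # gs) = Word [g] + Word gs" by (simp add: plus_word_def)
    then have "Poly_Mapping.single (Word (g # gs)) (1::real) = gen g * Poly_Mapping.single (Word gs) 1"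
      by (simp add: gen_def Poly_Mapping.mult_single)
    with Cons show ?case by simp
  qed
  show ?thesis
    using *[of "letters w"] by (simp add: scaleR_poly_mapping_def Poly_Mapping.mult_single flip: *)
qed

text \<open>Each element is a finite sum of scalar multiples of products of generators, so the four
  cases reach all of them.\<close>

lemma free_algebra_induct [case_names scalar gen add mult]:
  fixes p :: "'g free_algebra"
  assumes scalar: "\<And>c. P (of_real c)" and gen: "\<And>g. P (gen g)"
    and add: "\<And>p r. P p \<Longrightarrow> P r \<Longrightarrow> P (p + r)" and mult: "\<And>p r. P p \<Longrightarrow> P r \<Longrightarrow> P (p * r)"
  shows "P p"
proof (induction p rule: update_induct)
  case const
  then show ?case using scalar[of 0] by simp
next
  case (update f w c)
  have word: "P (prod_list (map gen gs))" for gs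
    by (induction gs) (use scalar[of 1] gen mult in auto)
  have "Poly_Mapping.update w c f = f + of_real c * prod_list (map gen (letters w))"
    unfolding scaleR_conv_of_real[symmetric] single_word_eq[symmetric]
    using update.hyps(1) by (rule update_eq_add_single)
  then show ?case
    using update.IH add mult scalar word by presburger
qed

section \<open>Evaluation homomorphisms of the free algebra\<close>

definition free_lift :: "('g \<Rightarrow> 'a) \<Rightarrow> 'g free_algebra \<Rightarrow> 'a::real_algebra_1" where
  "free_lift f p =
     (\<Sum>w\<in>Poly_Mapping.keys p. Poly_Mapping.lookup p w *\<^sub>R prod_list (map f (letters w)))"

text \<open>Supports change under addition and scaling; padding with zero coefficients puts the sums
  over a common index set.\<close>

lemma free_lift_superset:
  assumes "finite S" "Poly_Mapping.keys p \<subseteq> S"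
  shows "free_lift f p = (\<Sum>w\<in>S. Poly_Mapping.lookup p w *\<^sub>R prod_list (map f (letters w)))"
  unfolding free_lift_def using assms by (intro sum.mono_neutral_left) (auto simp: in_keys_iff)

lemma free_lift_add: "free_lift f (p + r) = free_lift f p + free_lift f r"
proof -
  let ?S = "Poly_Mapping.keys p \<union> Poly_Mapping.keys r"
  have "finite ?S" "Poly_Mapping.keys (p + r) \<subseteq> ?S"
    by (simp_all add: Poly_Mapping.keys_add)
  then show ?thesis
    by (simp add: free_lift_superset[of ?S] lookup_add scaleR_left_distrib sum.distrib)
qed

lemma free_lift_scaleR: "free_lift f (c *\<^sub>R p) = c *\<^sub>R free_lift f p"
proof -
  have "Poly_Mapping.keys (c *\<^sub>R p) \<subseteq> Poly_Mapping.keys p"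
    by (auto simp: in_keys_iff lookup_scaleR_free_algebra)
  then show ?thesis
    by (simp add: free_lift_superset[of "Poly_Mapping.keys p"] lookup_scaleR_free_algebra scaleR_sum_right)
qed

lemma free_lift_single: "free_lift f (Poly_Mapping.single w c) = c *\<^sub>R prod_list (map f (letters w))"
  by (cases "c = 0") (simp_all add: free_lift_def)

lemma letters_0: "letters 0 = []"
  by (simp add: zero_word_def)

lemma free_lift_1 [simp]: "free_lift f 1 = 1"
  using free_lift_single[of f 0 1] by (simp add: letters_0)

lemma free_lift_gen [simp]: "free_lift f (gen g) = f g"
  by (simp add: gen_def free_lift_single)

lemma free_lift_of_real [simp]: "free_lift f (of_real c) = of_real c"
  by (simp add: of_real_def free_lift_scaleR)

lemma free_lift_minus: "free_lift f (- p) = - free_lift f p"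
  using free_lift_scaleR[of f "-1" p] by simp

lemma free_lift_diff: "free_lift f (p - r) = free_lift f p - free_lift f r"
  using free_lift_add[of f p "- r"] by (simp add: free_lift_minus)

text \<open>With \<open>r\<close> arbitrary, a product on the left reduces to its factors by
  associativity. A single generator on the left needs an inner induction on the monomials of
  \<open>r\<close>, where it prepends one letter.\<close>

lemma free_lift_mult: "free_lift f (p * r) = free_lift f p * free_lift f r"
proof (induction p arbitrary: r rule: free_algebra_induct)
  case (scalar c)
  then show ?case by (simp add: free_lift_scaleR flip: scaleR_conv_of_real)
next
  case (gen g)
  then show ?case
  proof (induction r rule: update_induct)
    case const
    then show ?case by (simp add: free_lift_def)
  next
    case (update h w c)
    have "free_lift f (gen g * Poly_Mapping.single w c) = f g * free_lift f (Poly_Mapping.single w c)"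
      by (simp add: gen_def Poly_Mapping.mult_single free_lift_single plus_word_def)
    then show ?case
      using update by (simp add: update_eq_add_single distrib_left free_lift_add)
  qed
next
  case (add p s)
  then show ?case by (simp add: distrib_right free_lift_add)
next
  case (mult p s)
  then show ?case by (simp add: mult.assoc)
qed

lemmas free_lift_simps =
  free_lift_add free_lift_diff free_lift_minus free_lift_mult free_lift_scaleR

section \<open>Presented algebras\<close>

abbreviation rel_ideal :: "'g free_algebra set \<Rightarrow> 'g free_algebra set" where
  "rel_ideal R \<equiv> Idl\<^bsub>free_algebra_ring\<^esub> R"

lemma free_algebra_ring_simps [simp]:
  "carrier free_algebra_ring = UNIV"
  "x \<otimes>\<^bsub>free_algebra_ring\<^esub> y = x * y"
  "x \<oplus>\<^bsub>free_algebra_ring\<^esub> y = x + y"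
  "\<one>\<^bsub>free_algebra_ring\<^esub> = 1"
  "\<zero>\<^bsub>free_algebra_ring\<^esub> = 0"
  by (simp_all add: free_algebra_ring_def)

lemma ring_free_algebra_ring: "ring (free_algebra_ring :: 'g free_algebra ring)"
proof (rule ringI)
  show "abelian_group (free_algebra_ring :: 'g free_algebra ring)"
    by (rule abelian_groupI) (auto simp: algebra_simps intro: exI[of _ "- _"])
  show "monoid (free_algebra_ring :: 'g free_algebra ring)"
    by (rule monoidI) (auto simp: algebra_simps)
qed (auto simp: algebra_simps)

lemma free_algebra_a_inv [simp]: "\<ominus>\<^bsub>free_algebra_ring\<^esub> x = - x"
proof -
  interpret ring "free_algebra_ring :: 'a free_algebra ring" by (rule ring_free_algebra_ring)
  show ?thesis by (rule minus_equality) auto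
qed

lemma free_algebra_idealI:
  fixes I :: "'g free_algebra set"
  assumes "0 \<in> I" "\<And>x y. x \<in> I \<Longrightarrow> y \<in> I \<Longrightarrow> x - y \<in> I"
    "\<And>x y. x \<in> I \<Longrightarrow> y * x \<in> I" "\<And>x y. x \<in> I \<Longrightarrow> x * y \<in> I"
  shows "ideal I free_algebra_ring"
proof -
  interpret ring "free_algebra_ring :: 'g free_algebra ring" by (rule ring_free_algebra_ring)
  have neg: "- x \<in> I" if "x \<in> I" for x
    using assms(2)[OF assms(1) that] by simp
  have sub: "subgroup I (add_monoid (free_algebra_ring :: 'g free_algebra ring))"
  proof (rule add.subgroupI)
    show "\<And>a b. a \<in> I \<Longrightarrow> b \<in> I \<Longrightarrow> a \<oplus>\<^bsub>free_algebra_ring\<^esub> b \<in> I"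
      using assms(2) neg by (metis diff_minus_eq_add free_algebra_ring_simps(3))
  qed (use assms(1) neg in auto)
  show ?thesis
    by (rule idealI) (use assms(3,4) sub ring_free_algebra_ring in auto)
qed

lemma ideal_rel_ideal: "ideal (rel_ideal R) free_algebra_ring"
  by (rule ring.genideal_ideal[OF ring_free_algebra_ring]) simp

lemma rel_ideal_incl: "r \<in> R \<Longrightarrow> r \<in> rel_ideal R"
  using ring.genideal_self[OF ring_free_algebra_ring, of R] by auto

lemma rel_ideal_mult:
  assumes "x \<in> rel_ideal R"
  shows "y * x \<in> rel_ideal R" "x * y \<in> rel_ideal R"
  using ideal.I_l_closed[OF ideal_rel_ideal assms, of y] ideal.I_r_closed[OF ideal_rel_ideal assms, of y]
  by simp_all

lemma rel_ideal_add: "x \<in> rel_ideal R \<Longrightarrow> y \<in> rel_ideal R \<Longrightarrow> x + y \<in> rel_ideal R"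
  using additive_subgroup.a_closed[OF ideal.axioms(1)[OF ideal_rel_ideal], of x R y] by simp

lemma rel_ideal_scaleR: "x \<in> rel_ideal R \<Longrightarrow> c *\<^sub>R x \<in> rel_ideal R"
  unfolding scaleR_conv_of_real by (rule rel_ideal_mult)

lemma rel_ideal_diff: "x \<in> rel_ideal R \<Longrightarrow> y \<in> rel_ideal R \<Longrightarrow> x - y \<in> rel_ideal R"
  using rel_ideal_add[of x R "-1 *\<^sub>R y"] rel_ideal_scaleR[of y R "-1"] by simp

lemma rel_ideal_0: "0 \<in> rel_ideal R"
  using additive_subgroup.zero_closed[OF ideal.axioms(1)[OF ideal_rel_ideal], of R] by simp

lemmas rel_ideal_intros = rel_ideal_add rel_ideal_diff rel_ideal_scaleR rel_ideal_mult

section \<open>Cosets and the operations of the quotient\<close>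

lemma mem_rel_class_iff: "x \<in> rel_class R y \<longleftrightarrow> x - y \<in> rel_ideal R"
proof -
  have "x \<in> rel_class R y \<longleftrightarrow> (\<exists>i\<in>rel_ideal R. x = i + y)"
    by (auto simp: rel_class_def a_r_coset_def')
  then show ?thesis by (auto intro: bexI[of _ "x - y"])
qed

lemma rel_class_eq_iff: "rel_class R x = rel_class R y \<longleftrightarrow> x - y \<in> rel_ideal R"
proof
  assume "rel_class R x = rel_class R y"
  then show "x - y \<in> rel_ideal R"
    using mem_rel_class_iff[of x R x] rel_ideal_0 mem_rel_class_iff[of x R y] by simp
next
  assume xy: "x - y \<in> rel_ideal R"
  have "z - x \<in> rel_ideal R \<longleftrightarrow> z - y \<in> rel_ideal R" for z
    using rel_ideal_add[of "z - x" R "x - y"] rel_ideal_diff[of "z - y" R "x - y"] xy by auto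
  then show "rel_class R x = rel_class R y"
    by (auto simp: mem_rel_class_iff)
qed

lemma rel_class_hom: "rel_class R \<in> ring_hom free_algebra_ring (presented_algebra R)"
  using ideal.rcos_ring_hom[OF ideal_rel_ideal, of R]
  unfolding presented_algebra_def rel_class_def[abs_def] .

lemma ring_presented_algebra: "ring (presented_algebra R)"
  unfolding presented_algebra_def by (rule ideal.quotient_is_ring[OF ideal_rel_ideal])

lemma carrier_presented_algebra: "carrier (presented_algebra R) = range (rel_class R)"
  by (auto simp: presented_algebra_def rel_class_def FactRing_def A_RCOSETS_def' )

lemma rel_class_mult: "rel_class R x \<otimes>\<^bsub>presented_algebra R\<^esub> rel_class R y = rel_class R (x * y)"
  using ring_hom_mult[OF rel_class_hom, of x y R] by simp

lemma rel_class_add: "rel_class R x \<oplus>\<^bsub>presented_algebra R\<^esub> rel_class R y = rel_class R (x + y)"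
  using ring_hom_add[OF rel_class_hom, of x y R] by simp

lemma rel_class_one: "\<one>\<^bsub>presented_algebra R\<^esub> = rel_class R 1"
  using ring_hom_one[OF rel_class_hom, of R] by simp

lemma rel_class_a_inv: "\<ominus>\<^bsub>presented_algebra R\<^esub> rel_class R x = rel_class R (- x)"
proof -
  interpret ring_hom_ring free_algebra_ring "presented_algebra R" "rel_class R"
    by (intro ring_hom_ringI2 ring_free_algebra_ring ring_presented_algebra rel_class_hom)
  show ?thesis using hom_a_inv[of x] by simp
qed

text \<open>The commutator with \<open>s\<close> is a derivation and vanishes on scalars, so modulo
  the ideal it vanishes everywhere once it does so on generators.\<close>

lemma rel_class_central:
  assumes "\<And>g. s * gen g - gen g * s \<in> rel_ideal R"
  shows "s * x - x * s \<in> rel_ideal R"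
proof (induction x rule: free_algebra_induct)
  case (scalar c)
  then show ?case by (simp add: rel_ideal_0 of_real_def)
next
  case (gen g)
  then show ?case by (rule assms)
next
  case (add p r)
  then show ?case
    using rel_ideal_add[OF add] by (simp add: algebra_simps)
next
  case (mult p r)
  have "s * (p * r) - p * r * s = (s * p - p * s) * r + p * (s * r - r * s)"
    by (simp add: algebra_simps)
  then show ?case using mult by (simp add: rel_ideal_intros)
qed

section \<open>Homomorphisms out of a presented algebra\<close>

text \<open>All members of the union coincide as soon as \<open>f\<close> sends the relators in \<open>R\<close> into the
  ideal generated by \<open>S\<close>, for \<open>u\<close> a coset modulo \<open>R\<close>.\<close>

definition induced_hom ::
    "'h free_algebra set \<Rightarrow> ('g \<Rightarrow> 'h free_algebra) \<Rightarrow> 'g free_algebra set \<Rightarrow> 'h free_algebra set" where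
  "induced_hom S f u = (\<Union>x\<in>u. rel_class S (free_lift f x))"

context
  fixes R :: "'g free_algebra set" and S :: "'h free_algebra set" and f :: "'g \<Rightarrow> 'h free_algebra"
  assumes relations: "\<And>r. r \<in> R \<Longrightarrow> free_lift f r \<in> rel_ideal S"
begin

text \<open>The preimage of an ideal under the evaluation is an ideal; it contains \<open>R\<close>,
  hence the ideal generated by \<open>R\<close>.\<close>

lemma free_lift_rel_ideal: "x \<in> rel_ideal R \<Longrightarrow> free_lift f x \<in> rel_ideal S"
proof -
  have "ideal {x. free_lift f x \<in> rel_ideal S} free_algebra_ring"
    using free_lift_of_real[of f 0]
    by (intro free_algebra_idealI) (auto simp: free_lift_simps rel_ideal_0 intro: rel_ideal_intros)
  then have "rel_ideal R \<subseteq> {x. free_lift f x \<in> rel_ideal S}"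
    using relations by (intro ring.genideal_minimal[OF ring_free_algebra_ring]) auto
  then show "x \<in> rel_ideal R \<Longrightarrow> free_lift f x \<in> rel_ideal S" by auto
qed

lemma induced_hom_class [simp]:
  "induced_hom S f (rel_class R x) = rel_class S (free_lift f x)"
proof -
  have "rel_class S (free_lift f y) = rel_class S (free_lift f x)" if "y \<in> rel_class R x" for y
    using free_lift_rel_ideal[of "y - x"] that
    by (simp add: mem_rel_class_iff rel_class_eq_iff free_lift_diff)
  \<comment> \<open>A union of equal sets is their common value only over a nonempty index
    set.\<close>
  moreover have "x \<in> rel_class R x"
    by (simp add: mem_rel_class_iff rel_ideal_0)
  ultimately show ?thesis
    unfolding induced_hom_def by (intro SUP_eq_const) blast+
qed

lemma induced_hom_real_algebra_hom: "induced_hom S f \<in> real_algebra_hom R S"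
  unfolding real_algebra_hom_def
  by (auto intro!: ring_hom_memI
      simp: carrier_presented_algebra rel_class_mult rel_class_add rel_class_one free_lift_simps)

text \<open>One inclusion is by induction on free algebra elements, the other by induction on the
  generated ring, whose operations lift to representatives.\<close>

lemma induced_hom_image:
  "induced_hom S f ` carrier (presented_algebra R) = generated_subalgebra S (rel_class S ` range f)"
proof -
  let ?P = "presented_algebra S"
  let ?G = "rel_class S ` range f \<union> range (\<lambda>c. rel_class S (of_real c))"
  have image: "induced_hom S f ` carrier (presented_algebra R) = range (\<lambda>x. rel_class S (free_lift f x))"
    by (simp add: carrier_presented_algebra image_image)
  have "rel_class S (free_lift f x) \<in> generate_ring ?P ?G" for x
  proof (induction x rule: free_algebra_induct)
    case (add p r)
    then show ?case
      using generate_ring.eng_add[OF add] by (simp add: rel_class_add free_lift_add)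
  next
    case (mult p r)
    then show ?case
      using generate_ring.eng_mult[OF mult] by (simp add: rel_class_mult free_lift_mult)
  qed (auto intro: generate_ring.incl)
  moreover have "y \<in> range (\<lambda>x. rel_class S (free_lift f x))" if "y \<in> generate_ring ?P ?G" for y
    using that
  proof induction
    case one
    have "rel_class S 1 = rel_class S (free_lift f 1)" by simp
    then show ?case unfolding rel_class_one by blast
  next
    case (incl h)
    then consider g where "h = rel_class S (free_lift f (gen g))"
      | c where "h = rel_class S (free_lift f (of_real c))" by auto
    then show ?case by cases blast+
  next
    case (a_inv h)
    then show ?case
      by (clarsimp simp: rel_class_a_inv) (metis free_lift_minus rangeI)
  next
    case (eng_add h k)
    then show ?case
      by (clarsimp simp: rel_class_add) (metis free_lift_add rangeI)
  next
    case (eng_mult h k)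
    then show ?case
      by (clarsimp simp: rel_class_mult) (metis free_lift_mult rangeI)
  qed
  ultimately show ?thesis
    unfolding image generated_subalgebra_def by auto
qed

end

section \<open>Closure and comparison of generated subalgebras\<close>

lemma generated_subalgebra_scaleR:
  assumes "rel_class S x \<in> generated_subalgebra S G"
  shows "rel_class S (c *\<^sub>R x) \<in> generated_subalgebra S G"
  unfolding scaleR_conv_of_real rel_class_mult[symmetric] generated_subalgebra_def
  by (rule generate_ring.eng_mult)
    (use assms in \<open>auto simp: generated_subalgebra_def intro: generate_ring.incl\<close>)

lemma generated_subalgebra_add:
  assumes "rel_class S x \<in> generated_subalgebra S G" "rel_class S y \<in> generated_subalgebra S G"
  shows "rel_class S (x + y) \<in> generated_subalgebra S G"
  using generate_ring.eng_add[OF assms[unfolded generated_subalgebra_def]]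
  by (simp add: generated_subalgebra_def rel_class_add)

lemma generated_subalgebra_incl: "u \<in> G \<Longrightarrow> u \<in> generated_subalgebra S G"
  by (simp add: generated_subalgebra_def generate_ring.incl)

lemma generated_subalgebra_of_real: "rel_class S (of_real c) \<in> generated_subalgebra S G"
  by (simp add: generated_subalgebra_def generate_ring.incl)

text \<open>The larger side is itself a generated subalgebra, so it already contains the scalars and
  only \<open>G\<close> has to be checked.\<close>

lemma generated_subalgebra_minimal:
  assumes "G \<subseteq> generated_subalgebra S H"
  shows "generated_subalgebra S G \<subseteq> generated_subalgebra S H"
proof
  fix u
  assume "u \<in> generated_subalgebra S G"
  then show "u \<in> generated_subalgebra S H"
    unfolding generated_subalgebra_def
    by induction
      (use assms in \<open>auto simp: generated_subalgebra_def intro: generate_ring.intros\<close>)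
qed

section \<open>The Pastro algebra\<close>

context
  fixes q a b :: real
  assumes q: "q \<noteq> 0"
begin

text \<open>Naming the relators keeps the right-hand sides of the cofactor identities visible as
  combinations of ideal members.\<close>

qualified definition "relator\<^sub>1 = (q *\<^sub>R (X * Y) - Y * X) - 1"
qualified definition "relator\<^sub>2 =
  (q *\<^sub>R (Y * Z) - Z * Y) - (alpha1 q a b *\<^sub>R X + of_real (alpha2 q a b))"
qualified definition "relator\<^sub>3 = (q *\<^sub>R (Z * X) - X * Z) - 1"

interpretation pastro_cofactors q "q powi (-1)" "alpha1 q a b" "alpha2 q a b" X Y Z
  relator\<^sub>1 relator\<^sub>2 relator\<^sub>3 "pastro_Q q a b"
proof
  have sq: "q powi (-2) = (q powi (-1))^2"
    by (simp add: power_int_minus power_inverse)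
  show "q * q powi (-1) = 1"
    using q by (simp add: power_int_minus)
  show "pastro_Q q a b = ((q powi (-1))^2 - 1) *\<^sub>R (X * Y * Z) + (q powi (-1) * alpha1 q a b) *\<^sub>R X^2
      + (q powi (-1) * (q powi (-1) + 1)) *\<^sub>R (alpha2 q a b *\<^sub>R X + q powi (-1) *\<^sub>R Y + Z)"
    unfolding pastro_Q_def sq ..
qed (fact relator\<^sub>1_def relator\<^sub>2_def relator\<^sub>3_def)+

lemma relators_mem:
  "relator\<^sub>1 \<in> rel_ideal (pastro_rels q a b)"
  "relator\<^sub>2 \<in> rel_ideal (pastro_rels q a b)"
  "relator\<^sub>3 \<in> rel_ideal (pastro_rels q a b)"
  unfolding relator\<^sub>1_def relator\<^sub>2_def relator\<^sub>3_def pastro_rels_def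
  by (rule rel_ideal_incl, blast)+

text \<open>By the derivation argument the three generators suffice, and for each the cofactor
  identity displays the commutator as an ideal member.\<close>

lemma pastro_Q_central: "pastro_Q q a b * x - x * pastro_Q q a b \<in> rel_ideal (pastro_rels q a b)"
proof (rule rel_class_central)
  show "pastro_Q q a b * gen g - gen g * pastro_Q q a b \<in> rel_ideal (pastro_rels q a b)" for g
    by (cases g; hypsubst; unfold Q_comm_x Q_comm_y Q_comm_z; blast intro: rel_ideal_intros relators_mem)
qed

lemma pastro_zm_relation:
  "q *\<^sub>R (Z * pastro_M q a b \<mu>) - pastro_M q a b \<mu> * Z - of_real (\<mu> * alpha1 q a b) \<in> rel_ideal (pastro_rels q a b)"
  unfolding zm_relation[OF pastro_L_def pastro_M_def]
  by (blast intro: rel_ideal_intros relators_mem)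

lemma pastro_ml_relation:
  "q *\<^sub>R (pastro_M q a b \<mu> * pastro_L \<mu>) - pastro_L \<mu> * pastro_M q a b \<mu>
    - ((\<mu> * q powi (-1) * (q + 1)^2 * (q - 1)) *\<^sub>R Z
       - (\<mu> * q^2 * (q - 1)) *\<^sub>R pastro_Q q a b + of_real (\<mu>^2 * alpha1 q a b)) \<in> rel_ideal (pastro_rels q a b)"
  unfolding ml_relation[OF pastro_L_def pastro_M_def]
  by (blast intro: rel_ideal_intros relators_mem)

end

section \<open>The realisation of the $q$-Hahn algebra\<close>

definition hahn_images :: "real \<Rightarrow> real \<Rightarrow> real \<Rightarrow> real \<Rightarrow> hahn_gen \<Rightarrow> pastro_gen free_algebra" where
  "hahn_images q a b \<mu> g = (case g of
       HA \<Rightarrow> pastro_L \<mu>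
     | HB \<Rightarrow> Z
     | HC \<Rightarrow> pastro_M q a b \<mu>
     | H\<gamma>1 \<Rightarrow> of_real (\<mu> * alpha2 q a b + 1)
     | H\<gamma>2 \<Rightarrow> of_real (\<mu> * alpha1 q a b)
     | H\<gamma>3 \<Rightarrow> of_real (\<mu> * q powi (-1) * (q + 1)^2 * (q - 1))
     | H\<gamma>4 \<Rightarrow> - ((\<mu> * q^2 * (q - 1)) *\<^sub>R pastro_Q q a b) + of_real (\<mu>^2 * alpha1 q a b))"

text \<open>The first relator is sent to 0 already in the free algebra, by the definition of
  \<open>M\<close>; the next two are the relations of \<open>L, M, Z\<close>, and the rest follow
  from centrality of \<open>Q\<close>.\<close>

lemma hahn_images_relations:
  assumes q: "q \<noteq> 0" and r: "r \<in> hahn_rels q"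
  shows "free_lift (hahn_images q a b \<mu>) r \<in> rel_ideal (pastro_rels q a b)"
proof -
  let ?f = "hahn_images q a b \<mu>" and ?I = "rel_ideal (pastro_rels q a b)"
  consider "r = (q *\<^sub>R (A * B) - B * A) - (C + \<gamma>1)" | "r = (q *\<^sub>R (B * C) - C * B) - \<gamma>2"
    | "r = (q *\<^sub>R (C * A) - A * C) - (\<gamma>3 * B + \<gamma>4)"
    | g x where "r = g * x - x * g" "g \<in> {\<gamma>1, \<gamma>2, \<gamma>3, \<gamma>4}"
    using r unfolding hahn_rels_def by blast
  then show ?thesis
  proof cases
    case 1
    have "free_lift ?f r = 0"
      unfolding 1 by (simp add: free_lift_simps hahn_images_def pastro_M_def)
    then show ?thesis by (simp add: rel_ideal_0)
  next
    case 2
    then show ?thesis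
      using pastro_zm_relation[OF q, where \<mu> = \<mu>] by (simp add: free_lift_simps hahn_images_def)
  next
    case 3
    \<comment> \<open>Since \<open>\<gamma>3\<close> is sent to a multiple of the unit,
      \<open>\<gamma>3 * B\<close> becomes a product with \<open>of_real\<close>, which has to be
      matched with a scalar multiple of \<open>Z\<close>.\<close>
    have "free_lift ?f r = q *\<^sub>R (pastro_M q a b \<mu> * pastro_L \<mu>) - pastro_L \<mu> * pastro_M q a b \<mu>
        - ((\<mu> * q powi (-1) * (q + 1)^2 * (q - 1)) *\<^sub>R Z
           - (\<mu> * q^2 * (q - 1)) *\<^sub>R pastro_Q q a b + of_real (\<mu>^2 * alpha1 q a b))"
      unfolding 3 by (simp add: free_lift_simps hahn_images_def scaleR_conv_of_real[of _ Z])
    then show ?thesis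
      using pastro_ml_relation[OF q] by simp
  next
    case 4
    let ?x = "free_lift ?f x" and ?s = "\<mu> * q^2 * (q - 1)"
    \<comment> \<open>All four images have the form \<open>d *\<^sub>R Q + of_real c\<close>, with
      \<open>d = 0\<close> for the first three and \<open>d = - ?s\<close> for
      \<open>\<gamma>4\<close>; the scalar part drops out of the commutator. The deleted rules would
      split the scalar that serves as \<open>c\<close>.\<close>
    have "(\<exists>c. free_lift ?f g = of_real c) \<or> (\<exists>c. free_lift ?f g = - (?s *\<^sub>R pastro_Q q a b) + of_real c)"
      using 4(2) by (auto simp: hahn_images_def simp del: of_real_add of_real_mult of_real_diff of_real_power)
    then obtain d c where g: "free_lift ?f g = d *\<^sub>R pastro_Q q a b + of_real c"
      by (metis add.left_neutral scaleR_minus_left scaleR_zero_left)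
    have "free_lift ?f r = d *\<^sub>R (pastro_Q q a b * ?x - ?x * pastro_Q q a b)"
      unfolding 4(1) free_lift_simps g by (simp add: algebra_simps of_real_def)
    then show ?thesis
      by (simp add: rel_ideal_scaleR pastro_Q_central[OF q])
  qed
qed

text \<open>The images of \<open>\<gamma>1\<close>, \<open>\<gamma>2\<close>,
  \<open>\<gamma>3\<close> are scalars and add nothing. The image of \<open>\<gamma>4\<close> is
  affine in \<open>Q\<close>, and a nonzero coefficient allows solving for \<open>Q\<close>.\<close>

lemma generated_subalgebra_hahn_images:
  fixes q a b \<mu> :: real
  defines "G \<equiv> rel_class (pastro_rels q a b) ` range (hahn_images q a b \<mu>)"
    and "H \<equiv> rel_class (pastro_rels q a b) ` {pastro_L \<mu>, pastro_M q a b \<mu>, Z, pastro_Q q a b}"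
  shows "generated_subalgebra (pastro_rels q a b) G \<subseteq> generated_subalgebra (pastro_rels q a b) H"
    and "\<mu> * q^2 * (q - 1) \<noteq> 0 \<Longrightarrow>
      generated_subalgebra (pastro_rels q a b) G = generated_subalgebra (pastro_rels q a b) H"
proof -
  let ?S = "pastro_rels q a b" and ?c = "\<mu> * q^2 * (q - 1)"
  let ?Q = "pastro_Q q a b" and ?\<gamma> = "hahn_images q a b \<mu> H\<gamma>4"
  note closure = generated_subalgebra_add generated_subalgebra_scaleR generated_subalgebra_of_real
  have \<gamma>: "?\<gamma> = (- ?c) *\<^sub>R ?Q + of_real (\<mu>^2 * alpha1 q a b)"
    by (simp add: hahn_images_def)
  have H: "rel_class ?S x \<in> generated_subalgebra ?S H"
    if "x \<in> {pastro_L \<mu>, pastro_M q a b \<mu>, Z, ?Q}" for x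
    unfolding H_def using that by (blast intro: generated_subalgebra_incl)
  have "rel_class ?S (hahn_images q a b \<mu> g) \<in> generated_subalgebra ?S H" for g
  proof (cases g)
    case H\<gamma>4
    then show ?thesis
      unfolding \<gamma> H\<gamma>4 by (intro closure H) simp
  qed (simp_all add: hahn_images_def H generated_subalgebra_of_real del: of_real_add of_real_mult
      of_real_diff of_real_power)
  then show le: "generated_subalgebra ?S G \<subseteq> generated_subalgebra ?S H"
    unfolding G_def by (intro generated_subalgebra_minimal) blast
  have G: "rel_class ?S (hahn_images q a b \<mu> g) \<in> generated_subalgebra ?S G" for g
    unfolding G_def by (blast intro: generated_subalgebra_incl)
  show "generated_subalgebra ?S G = generated_subalgebra ?S H" if c: "?c \<noteq> 0"
  proof (rule equalityI[OF le])
    \<comment> \<open>Cancellation is proved for a variable \<open>d\<close>, so that the product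
      \<open>?c\<close> is not broken up.\<close>
    have "?Q = (- inverse d) *\<^sub>R ((- d) *\<^sub>R ?Q)" if "d \<noteq> 0" for d
      using that by simp
    then have "?Q = (- inverse ?c) *\<^sub>R ((- ?c) *\<^sub>R ?Q)"
      using c by blast
    also have "\<dots> = (- inverse ?c) *\<^sub>R (?\<gamma> + of_real (- (\<mu>^2 * alpha1 q a b)))"
      unfolding \<gamma> by simp
    finally have "rel_class ?S ?Q \<in> generated_subalgebra ?S G"
      by (metis G closure)
    then have "H \<subseteq> generated_subalgebra ?S G"
      using G[of HA] G[of HB] G[of HC] unfolding H_def by (auto simp: hahn_images_def)
    then show "generated_subalgebra ?S H \<subseteq> generated_subalgebra ?S G"
      by (rule generated_subalgebra_minimal)
  qed
qed

theorem mainTheorem5: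
  fixes q a b \<mu> :: real
  assumes q_generic: "q \<noteq> 0" "\<forall>n::nat. n > 0 \<longrightarrow> q ^ n \<noteq> 1"
    and "a \<noteq> 0" and "b \<noteq> 0"
  shows
    "let P = pastro_algebra q a b; cl = pastro_class q a b;
         H = hahn_algebra q; hc = hahn_class q;
         \<alpha>\<^sub>1 = alpha1 q a b; \<alpha>\<^sub>2 = alpha2 q a b;
         Q = pastro_Q q a b; L = pastro_L \<mu>; M = pastro_M q a b \<mu>
     in
      (\<forall>u \<in> carrier P. cl Q \<otimes>\<^bsub>P\<^esub> u = u \<otimes>\<^bsub>P\<^esub> cl Q) \<and>
      cl (q *\<^sub>R (L * Z) - Z * L) = cl (M + of_real (\<mu> * \<alpha>\<^sub>2) + 1) \<and>
      cl (q *\<^sub>R (Z * M) - M * Z) = cl (of_real (\<mu> * \<alpha>\<^sub>1)) \<and>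
      cl (q *\<^sub>R (M * L) - L * M) =
        cl ((\<mu> * q powi (-1) * (q + 1)^2 * (q - 1)) *\<^sub>R Z
            - (\<mu> * q^2 * (q - 1)) *\<^sub>R Q + of_real (\<mu>^2 * \<alpha>\<^sub>1)) \<and>
      (\<exists>\<phi> \<in> real_algebra_hom (hahn_rels q) (pastro_rels q a b).
         \<phi> (hc A) = cl L \<and> \<phi> (hc B) = cl Z \<and> \<phi> (hc C) = cl M \<and>
         \<phi> (hc \<gamma>1) = cl (of_real (\<mu> * \<alpha>\<^sub>2 + 1)) \<and>
         \<phi> (hc \<gamma>2) = cl (of_real (\<mu> * \<alpha>\<^sub>1)) \<and>
         \<phi> (hc \<gamma>3) = cl (of_real (\<mu> * q powi (-1) * (q + 1)^2 * (q - 1))) \<and>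
         \<phi> (hc \<gamma>4) = cl (- ((\<mu> * q^2 * (q - 1)) *\<^sub>R Q) + of_real (\<mu>^2 * \<alpha>\<^sub>1)) \<and>
         \<phi> ` carrier H \<subseteq> generated_subalgebra (pastro_rels q a b) {cl L, cl M, cl Z, cl Q} \<and>
         (\<mu> \<noteq> 0 \<longrightarrow>
           \<phi> ` carrier H = generated_subalgebra (pastro_rels q a b) {cl L, cl M, cl Z, cl Q}))"
proof -
  define S where "S = pastro_rels q a b"
  define \<phi> where "\<phi> = induced_hom S (hahn_images q a b \<mu>)"
  note rels = hahn_images_relations[OF q_generic(1), of _ a b \<mu>, folded S_def]
  have \<phi>: "\<phi> (hahn_class q x) = rel_class S (free_lift (hahn_images q a b \<mu>) x)" for x
    unfolding \<phi>_def using rels by (rule induced_hom_class)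
  have image: "\<phi> ` carrier (hahn_algebra q)
      = generated_subalgebra S (rel_class S ` range (hahn_images q a b \<mu>))"
    unfolding \<phi>_def using rels by (rule induced_hom_image)
  have "\<phi> \<in> real_algebra_hom (hahn_rels q) S"
    unfolding \<phi>_def using rels by (rule induced_hom_real_algebra_hom)
  \<comment> \<open>Genericity at exponent 1 gives \<open>q \<noteq> 1\<close>, so the coefficient
    of \<open>Q\<close> in the image of \<open>\<gamma>4\<close> is nonzero for nonzero
    \<open>\<mu>\<close>.\<close>
  moreover have "\<mu> * q^2 * (q - 1) \<noteq> 0" if "\<mu> \<noteq> 0"
    using that q_generic(1) q_generic(2)[rule_format, of 1] by simp
  then have "\<phi> ` carrier (hahn_algebra q) \<subseteq> generated_subalgebra S
        {rel_class S (pastro_L \<mu>), rel_class S (pastro_M q a b \<mu>), rel_class S Z, rel_class S (pastro_Q q a b)}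
    \<and> (\<mu> \<noteq> 0 \<longrightarrow> \<phi> ` carrier (hahn_algebra q) = generated_subalgebra S
        {rel_class S (pastro_L \<mu>), rel_class S (pastro_M q a b \<mu>), rel_class S Z, rel_class S (pastro_Q q a b)})"
    using generated_subalgebra_hahn_images[where q = q and a = a and b = b and \<mu> = \<mu>, folded S_def,
        unfolded image_insert image_empty]
    unfolding image by blast
  moreover have "\<forall>u\<in>carrier (presented_algebra S). rel_class S (pastro_Q q a b) \<otimes>\<^bsub>presented_algebra S\<^esub> u
      = u \<otimes>\<^bsub>presented_algebra S\<^esub> rel_class S (pastro_Q q a b)"
    using pastro_Q_central[OF q_generic(1)]
    by (auto simp: S_def carrier_presented_algebra rel_class_mult rel_class_eq_iff)
  \<comment> \<open>This relation restates the definition of \<open>M\<close>: both representatives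
    are already equal in the free algebra.\<close>
  moreover have "rel_class S (q *\<^sub>R (pastro_L \<mu> * Z) - Z * pastro_L \<mu>)
      = rel_class S (pastro_M q a b \<mu> + of_real (\<mu> * alpha2 q a b) + 1)"
    unfolding pastro_M_def by (simp del: of_real_mult)
  moreover note
    pastro_zm_relation[OF q_generic(1), of a b \<mu>, folded rel_class_eq_iff S_def]
    pastro_ml_relation[OF q_generic(1), of a b \<mu>, folded rel_class_eq_iff S_def]
  moreover have "\<phi> (hahn_class q (gen g)) = rel_class S (hahn_images q a b \<mu> g)" for g
    by (simp add: \<phi>)
  note this[of HA] this[of HB] this[of HC] this[of H\<gamma>1] this[of H\<gamma>2] this[of H\<gamma>3] this[of H\<gamma>4]
  ultimately show ?thesis
    unfolding Let_def S_def[symmetric] hahn_images_def hahn_gen.case by blast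
qed

end
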